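(* Let $K$ be a finite group, let $H$ be a non-normal subgroup of $K$, let $x\in K$ be such that $\langle H,x\rangle=K$ and $x^2\in H$ with $|x|>2$, and define $S=H\cup\{x,x^{-1}\}$. If $S^3\ne K$, then the largest subset $T$ of $K$ satisfying $S^3=T^3$ with $T=T^{-1}$ and $S\subseteq T$ is $T=H\cup(Hx\cap xH)$.
   Context: For a subset $S$ of a group, $S^3=\{abc: a,b,c\in S\}$ and $S^{-1}=\{s^{-1}:s\in S\}$; $|x|$ denotes the order of the element $x$. *)

theory Defs
  imports "HOL-Algebra.Generated_Groups" "HOL-Algebra.Multiplicative_Group"
begin

definition cube :: "[('a, 'b) monoid_scheme, 'a set] \<Rightarrow> 'a set"
  where "cube G S = {a \<otimes>\<^bsub>G\<^esub> b \<otimes>\<^bsub>G\<^esub> c | a b c. a \<in> S \<and> b \<in> S \<and> c \<in> S}"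

definition symmetric_cube_supersets :: "[('a, 'b) monoid_scheme, 'a set] \<Rightarrow> 'a set set"
  where "symmetric_cube_supersets G S =
    {T. T \<subseteq> carrier G \<and> cube G S = cube G T \<and> T = set_inv\<^bsub>G\<^esub> T \<and> S \<subseteq> T}"

end

theory Submission
  imports Defs
begin

text \<open>
  Write \<open>D\<close> for the double coset \<open>HxH\<close>. Since \<open>x\<^sup>2 \<in> H\<close>, the inverse of \<open>x\<close> lies in both \<open>xH\<close> and
  \<open>Hx\<close>, and \<open>xHx\<close> is the conjugate \<open>xHx\<inverse>\<close>. Put \<open>A = Hx \<inter> xH\<close>. A product of two elements of \<open>A\<close>
  lies in \<open>Hx\<^sup>2H = H\<close>, so every product of three elements of \<open>H \<union> A\<close> lies in \<open>H \<union> D \<union> xHx\<close>; and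
  that set is already covered by the cube of \<open>H \<union> {x}\<close>. Hence every set between \<open>H \<union> {x}\<close> and
  \<open>H \<union> A\<close> has this same cube (\<open>cube_eq_cube_union\<close>), which settles the membership claim.

  For maximality, let \<open>T\<close> be a symmetric superset with the same cube \<open>C = H \<union> D \<union> xHx\<close>, and let
  \<open>t \<in> T\<close>. Multiplying by \<open>1 \<in> T\<close> gives \<open>t \<in> C\<close>, and two obstructions force \<open>t \<in> H \<union> A\<close>.

  If \<open>t \<in> D\<close> is outside \<open>xH\<close>, write \<open>t = hxk\<close>. Then \<open>tHx = h(xHx)\<close> is contained in \<open>C\<close> but is
  disjoint from \<open>xHx\<close>, because \<open>h\<close> lies outside the subgroup \<open>xHx = xHx\<inverse>\<close> and so \<open>h(xHx)\<close> is
  another of its cosets. Hence \<open>xHx \<subseteq> H \<union> D\<close>, which makes \<open>H \<union> D\<close> a subgroup containing \<open>H\<close> and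
  \<open>x\<close>, so that \<open>C = K\<close>, which is excluded. The same argument for \<open>t\<inverse>\<close> gives \<open>t \<in> Hx\<close>.

  If \<open>t \<in> xHx\<close> is outside \<open>H \<union> D\<close>, then so is all of \<open>Ht\<close>, whence \<open>Ht \<subseteq> xHx\<close>. This says
  \<open>H \<subseteq> xHx\<inverse>\<close>, so \<open>x\<close> normalises \<open>H\<close> and \<open>H\<close> is normal, which is excluded as well.
\<close>

section \<open>Cubes and normality\<close>

lemma cube_mono: "S \<subseteq> T \<Longrightarrow> cube G S \<subseteq> cube G T"
  unfolding cube_def by blast

lemma cubeI: "\<lbrakk>a \<in> S; b \<in> S; c \<in> S\<rbrakk> \<Longrightarrow> a \<otimes>\<^bsub>G\<^esub> b \<otimes>\<^bsub>G\<^esub> c \<in> cube G S"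
  unfolding cube_def by blast

lemma (in group) normal_if_generators_normalise:
  assumes H: "subgroup H G" and A: "A \<subseteq> carrier G" and gen: "generate G A = carrier G"
    and conj: "\<And>a h. \<lbrakk>a \<in> A; h \<in> H\<rbrakk> \<Longrightarrow> a \<otimes> h \<otimes> inv a \<in> H"
    and conj_inv: "\<And>a h. \<lbrakk>a \<in> A; h \<in> H\<rbrakk> \<Longrightarrow> inv a \<otimes> h \<otimes> a \<in> H"
  shows "H \<lhd> G"
proof -
  have "\<forall>h\<in>H. g \<otimes> h \<otimes> inv g \<in> H" if "g \<in> generate G A" for g
    using that
  proof (induction rule: generate.induct)
    case one
    then show ?case using subgroup.mem_carrier[OF H] by simp
  next
    case (incl a)
    then show ?case using conj by blast
  next
    case (inv a)
    then show ?case using conj_inv A by auto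
  next
    case (eng a b)
    have ab: "a \<in> carrier G" "b \<in> carrier G" using eng.hyps gen by auto
    show ?case
    proof
      fix h assume h: "h \<in> H"
      have "(a \<otimes> b) \<otimes> h \<otimes> inv (a \<otimes> b) = a \<otimes> (b \<otimes> h \<otimes> inv b) \<otimes> inv a"
        using ab subgroup.mem_carrier[OF H h] by (simp add: inv_mult_group m_assoc)
      then show "(a \<otimes> b) \<otimes> h \<otimes> inv (a \<otimes> b) \<in> H" using eng.IH h by simp
    qed
  qed
  then show ?thesis using H gen by (simp add: normal_inv_iff)
qed

section \<open>An element whose square lies in a subgroup\<close>

locale square_in_subgroup = group K for K :: "('a, 'b) monoid_scheme" (structure) +
  fixes H :: "'a set" and x :: 'a
  assumes H: "subgroup H K" and x: "x \<in> carrier K" and square: "x \<otimes> x \<in> H"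
begin

definition double_coset :: "'a set"
  where "double_coset = {h \<otimes> x \<otimes> k | h k. h \<in> H \<and> k \<in> H}"

text \<open>Because \<open>x\<^sup>2 \<in> H\<close>, this is the conjugate subgroup \<open>xHx\<inverse>\<close>. The form with two equal factors
  \<open>x\<close> is the one in which it occurs in a cube.\<close>

definition twist :: "'a set"
  where "twist = {x \<otimes> h \<otimes> x | h. h \<in> H}"

lemma H_carrier [simp]: "h \<in> H \<Longrightarrow> h \<in> carrier K"
  using subgroup.mem_carrier[OF H] .

lemma H_mult [simp]: "\<lbrakk>h \<in> H; k \<in> H\<rbrakk> \<Longrightarrow> h \<otimes> k \<in> H"
  using subgroup.m_closed[OF H] .

lemma H_inv [simp]: "h \<in> H \<Longrightarrow> inv h \<in> H"
  using subgroup.m_inv_closed[OF H] .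

lemma H_one [simp]: "\<one> \<in> H"
  using subgroup.one_closed[OF H] .

lemma x_carrier [simp]: "x \<in> carrier K"
  using x .

lemma inv_x_left: "inv x = inv (x \<otimes> x) \<otimes> x"
  by (simp add: inv_mult_group m_assoc)

lemma inv_x_right: "inv x = x \<otimes> inv (x \<otimes> x)"
  by (simp add: inv_mult_group m_assoc[symmetric])

lemma double_cosetI: "\<lbrakk>h \<in> H; k \<in> H\<rbrakk> \<Longrightarrow> h \<otimes> x \<otimes> k \<in> double_coset"
  unfolding double_coset_def by blast

lemma double_cosetE:
  assumes "d \<in> double_coset"
  obtains h k where "h \<in> H" "k \<in> H" "d = h \<otimes> x \<otimes> k"
  using assms unfolding double_coset_def by blast

lemma twistI: "h \<in> H \<Longrightarrow> x \<otimes> h \<otimes> x \<in> twist"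
  unfolding twist_def by blast

lemma double_coset_carrier: "d \<in> double_coset \<Longrightarrow> d \<in> carrier K"
  by (auto elim!: double_cosetE)

lemma double_coset_inv:
  assumes "d \<in> double_coset" shows "inv d \<in> double_coset"
proof -
  obtain h k where hk: "h \<in> H" "k \<in> H" and d: "d = h \<otimes> x \<otimes> k"
    using assms by (rule double_cosetE)
  have "inv d = inv k \<otimes> inv x \<otimes> inv h"
    using hk d by (simp add: inv_mult_group m_assoc)
  also have "\<dots> = (inv k \<otimes> inv (x \<otimes> x)) \<otimes> x \<otimes> inv h"
    using hk by (subst inv_x_left) (simp add: m_assoc)
  also have "\<dots> \<in> double_coset"
    using hk square by (intro double_cosetI) auto
  finally show ?thesis .
qed

lemma union_carrier: "d \<in> H \<union> double_coset \<Longrightarrow> d \<in> carrier K"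
  using double_coset_carrier by auto

lemma union_mult_left:
  assumes h: "h \<in> H" and d: "d \<in> H \<union> double_coset" shows "h \<otimes> d \<in> H \<union> double_coset"
  using d
proof
  assume "d \<in> double_coset"
  then obtain k l where kl: "k \<in> H" "l \<in> H" "d = k \<otimes> x \<otimes> l" by (rule double_cosetE)
  then have "h \<otimes> d = (h \<otimes> k) \<otimes> x \<otimes> l" using h by (simp add: m_assoc)
  then show ?thesis using h kl double_cosetI[of "h \<otimes> k" l] by simp
qed (use h in simp)

lemma union_mult_right:
  assumes h: "h \<in> H" and d: "d \<in> H \<union> double_coset" shows "d \<otimes> h \<in> H \<union> double_coset"
  using d
proof
  assume "d \<in> double_coset"
  then obtain k l where kl: "k \<in> H" "l \<in> H" "d = k \<otimes> x \<otimes> l" by (rule double_cosetE)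
  then have "d \<otimes> h = k \<otimes> x \<otimes> (l \<otimes> h)" using h by (simp add: m_assoc)
  then show ?thesis using h kl double_cosetI[of k "l \<otimes> h"] by simp
qed (use h in simp)

lemma union_mult_left_iff:
  assumes h: "h \<in> H" and d: "d \<in> carrier K"
  shows "h \<otimes> d \<in> H \<union> double_coset \<longleftrightarrow> d \<in> H \<union> double_coset"
proof
  assume "h \<otimes> d \<in> H \<union> double_coset"
  then have "inv h \<otimes> (h \<otimes> d) \<in> H \<union> double_coset" by (rule union_mult_left[OF H_inv[OF h]])
  then show "d \<in> H \<union> double_coset" using h d by (simp add: m_assoc[symmetric])
qed (rule union_mult_left[OF h])

text \<open>The only products that could leave \<open>H \<union> HxH\<close> are \<open>HxH \<cdot> HxH = H(xHx)H\<close>, and these are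
  controlled by \<open>xHx\<close>.\<close>

lemma subgroup_union:
  assumes twist: "twist \<subseteq> H \<union> double_coset"
  shows "subgroup (H \<union> double_coset) K"
proof
  show "H \<union> double_coset \<subseteq> carrier K" using union_carrier by blast
  show "\<one> \<in> H \<union> double_coset" by simp
  show "inv d \<in> H \<union> double_coset" if "d \<in> H \<union> double_coset" for d
    using that double_coset_inv by auto
next
  fix d e assume d: "d \<in> H \<union> double_coset" and e: "e \<in> H \<union> double_coset"
  show "d \<otimes> e \<in> H \<union> double_coset"
  proof (cases "d \<in> H \<or> e \<in> H")
    case True
    then show ?thesis using d e union_mult_left union_mult_right by blast
  next
    case False
    obtain h k where hk: "h \<in> H" "k \<in> H" "d = h \<otimes> x \<otimes> k"
      using d False by (auto elim: double_cosetE)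
    obtain l m where lm: "l \<in> H" "m \<in> H" "e = l \<otimes> x \<otimes> m"
      using e False by (auto elim: double_cosetE)
    have eq: "d \<otimes> e = h \<otimes> (x \<otimes> (k \<otimes> l) \<otimes> x) \<otimes> m"
      using hk lm by (simp add: m_assoc)
    have "x \<otimes> (k \<otimes> l) \<otimes> x \<in> H \<union> double_coset"
      using twist twistI[OF H_mult[OF hk(2) lm(1)]] by (rule subsetD)
    then show ?thesis unfolding eq
      by (rule union_mult_right[OF lm(2) union_mult_left[OF hk(1)]])
  qed
qed

lemma carrier_eq_union:
  assumes gen: "generate K (H \<union> {x}) = carrier K" and twist: "twist \<subseteq> H \<union> double_coset"
  shows "carrier K = H \<union> double_coset"
proof -
  have "x \<in> double_coset" using double_cosetI[of \<one> \<one>] by simp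
  then have "generate K (H \<union> {x}) \<subseteq> H \<union> double_coset"
    by (intro generate_subgroup_incl subgroup_union twist) auto
  then show ?thesis using gen union_carrier by blast
qed

lemma normal_if_x_normalises:
  assumes gen: "generate K (H \<union> {x}) = carrier K"
    and left_in_right: "\<And>h. h \<in> H \<Longrightarrow> h \<otimes> x \<in> x <# H"
  shows "H \<lhd> K"
proof (rule normal_if_generators_normalise[OF H _ gen])
  have conj_inv: "inv x \<otimes> h \<otimes> x \<in> H" if h: "h \<in> H" for h
  proof -
    obtain k where k: "k \<in> H" "h \<otimes> x = x \<otimes> k"
      using left_in_right[OF h] unfolding l_coset_def by blast
    have "inv x \<otimes> h \<otimes> x = inv x \<otimes> (h \<otimes> x)" using h by (simp add: m_assoc)
    also have "\<dots> = k" using k by (simp add: m_assoc[symmetric])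
    finally show ?thesis using k by simp
  qed
  \<comment> \<open>Conjugation by \<open>x\<close> and by \<open>x\<inverse>\<close> differ by conjugation by \<open>x\<^sup>2 \<in> H\<close>.\<close>
  have conj: "x \<otimes> h \<otimes> inv x \<in> H" if h: "h \<in> H" for h
  proof -
    have "inv x \<otimes> ((x \<otimes> x) \<otimes> h \<otimes> inv (x \<otimes> x)) \<otimes> x = (inv x \<otimes> x) \<otimes> (x \<otimes> h \<otimes> inv x) \<otimes> (inv x \<otimes> x)"
      using h by (simp only: inv_mult_group m_assoc m_closed inv_closed x_carrier H_carrier)
    also have "\<dots> = x \<otimes> h \<otimes> inv x" using h by simp
    finally show ?thesis using conj_inv[of "(x \<otimes> x) \<otimes> h \<otimes> inv (x \<otimes> x)"] h square by simp
  qed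
  show "H \<union> {x} \<subseteq> carrier K" by auto
  show "a \<otimes> h \<otimes> inv a \<in> H" if "a \<in> H \<union> {x}" "h \<in> H" for a h using that conj by auto
  show "inv a \<otimes> h \<otimes> a \<in> H" if "a \<in> H \<union> {x}" "h \<in> H" for a h using that conj_inv by auto
qed

section \<open>The common cube\<close>

abbreviation both_cosets :: "'a set"
  where "both_cosets \<equiv> (H #> x) \<inter> (x <# H)"

lemma both_cosetsE:
  assumes "a \<in> both_cosets"
  obtains h k where "h \<in> H" "k \<in> H" "a = h \<otimes> x" "a = x \<otimes> k"
  using assms unfolding r_coset_def l_coset_def by blast

lemma both_cosets_inv:
  assumes "a \<in> both_cosets" shows "inv a \<in> both_cosets"
proof -
  obtain h k where hk: "h \<in> H" "k \<in> H" "a = h \<otimes> x" "a = x \<otimes> k"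
    using assms by (rule both_cosetsE)
  have "inv a = inv k \<otimes> inv x" using hk(2) by (simp add: hk(4) inv_mult_group)
  also have "\<dots> = (inv k \<otimes> inv (x \<otimes> x)) \<otimes> x"
    using hk by (subst inv_x_left) (simp add: m_assoc)
  finally have "inv a \<in> H #> x" using hk square unfolding r_coset_def by auto
  have "inv a = inv x \<otimes> inv h" using hk(1) by (simp only: hk(3) inv_mult_group H_carrier x_carrier)
  also have "\<dots> = x \<otimes> (inv (x \<otimes> x) \<otimes> inv h)"
    using hk by (subst inv_x_right) (simp add: m_assoc)
  finally have "inv a \<in> x <# H" using hk square unfolding l_coset_def by auto
  then show ?thesis using \<open>inv a \<in> H #> x\<close> by simp
qed

lemma x_both_cosets: "x \<in> both_cosets"
  unfolding r_coset_def l_coset_def by (auto intro!: bexI[of _ \<one>])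

lemma both_cosets_mult:
  assumes "a \<in> both_cosets" "b \<in> both_cosets" shows "a \<otimes> b \<in> H"
proof -
  obtain h where h: "h \<in> H" "a = h \<otimes> x" using assms(1) by (rule both_cosetsE)
  obtain k where k: "k \<in> H" "b = x \<otimes> k" using assms(2) by (rule both_cosetsE)
  have "a \<otimes> b = h \<otimes> (x \<otimes> x) \<otimes> k" using h k by (simp add: m_assoc)
  then show ?thesis using h k square by simp
qed

lemma both_cosets_double_coset:
  assumes "h \<in> H" "a \<in> both_cosets" "k \<in> H" shows "h \<otimes> a \<otimes> k \<in> double_coset"
proof -
  obtain l where l: "l \<in> H" "a = l \<otimes> x" using assms(2) by (rule both_cosetsE)
  have "h \<otimes> a \<otimes> k = (h \<otimes> l) \<otimes> x \<otimes> k" using assms l by (simp add: m_assoc)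
  then show ?thesis using assms l double_cosetI by simp
qed

lemma both_cosets_twist:
  assumes "a \<in> both_cosets" "h \<in> H" "b \<in> both_cosets" shows "a \<otimes> h \<otimes> b \<in> twist"
proof -
  obtain k where k: "k \<in> H" "a = x \<otimes> k" using assms(1) by (rule both_cosetsE)
  obtain l where l: "l \<in> H" "b = l \<otimes> x" using assms(3) by (rule both_cosetsE)
  have "a \<otimes> h \<otimes> b = x \<otimes> (k \<otimes> h \<otimes> l) \<otimes> x" using assms k l by (simp add: m_assoc)
  then show ?thesis using twistI[of "k \<otimes> h \<otimes> l"] assms(2) k l by simp
qed

lemma both_cosets_carrier: "a \<in> both_cosets \<Longrightarrow> a \<in> carrier K"
  by (erule both_cosetsE) simp

lemma cube_both_cosets_subset: "cube K (H \<union> both_cosets) \<subseteq> H \<union> double_coset \<union> twist"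
proof
  fix y assume "y \<in> cube K (H \<union> both_cosets)"
  then obtain a b c where abc: "a \<in> H \<union> both_cosets" "b \<in> H \<union> both_cosets" "c \<in> H \<union> both_cosets"
    and y: "y = a \<otimes> b \<otimes> c"
    unfolding cube_def by blast
  have car: "a \<in> carrier K" "b \<in> carrier K" "c \<in> carrier K"
    using abc both_cosets_carrier H_carrier by blast+
  consider (HHH) "a \<in> H" "b \<in> H" "c \<in> H"
    | (HHA) "a \<in> H" "b \<in> H" "c \<in> both_cosets"
    | (HAH) "a \<in> H" "b \<in> both_cosets" "c \<in> H"
    | (AHH) "a \<in> both_cosets" "b \<in> H" "c \<in> H"
    | (HAA) "a \<in> H" "b \<in> both_cosets" "c \<in> both_cosets"
    | (AHA) "a \<in> both_cosets" "b \<in> H" "c \<in> both_cosets"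
    | (AAH) "a \<in> both_cosets" "b \<in> both_cosets" "c \<in> H"
    | (AAA) "a \<in> both_cosets" "b \<in> both_cosets" "c \<in> both_cosets"
    using abc by (elim UnE; simp only:)
  then show "y \<in> H \<union> double_coset \<union> twist"
  proof cases
    case HHH
    then show ?thesis using y by simp
  next
    case HHA
    then show ?thesis using y car both_cosets_double_coset[of "a \<otimes> b" c \<one>] by simp
  next
    case HAH
    then show ?thesis using y both_cosets_double_coset[of a b c] by simp
  next
    case AHH
    then show ?thesis using y car both_cosets_double_coset[of \<one> a "b \<otimes> c"] by (simp add: m_assoc)
  next
    case HAA
    then show ?thesis using y car both_cosets_mult[of b c] by (simp add: m_assoc)
  next
    case AHA
    then show ?thesis using y both_cosets_twist[of a b c] by simp
  next
    case AAH
    then show ?thesis using y both_cosets_mult[of a b] by simp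
  next
    case AAA
    have "a \<otimes> b \<in> H" using AAA by (intro both_cosets_mult)
    then show ?thesis using y car AAA both_cosets_double_coset[of "a \<otimes> b" c \<one>] by simp
  qed
qed

lemma subset_cube:
  assumes "H \<subseteq> T" "x \<in> T" shows "H \<union> double_coset \<union> twist \<subseteq> cube K T"
proof -
  have "h \<in> cube K T" if h: "h \<in> H" for h
    using cubeI[of h T \<one> \<one> K] h assms(1) by (simp add: subset_iff)
  moreover have "double_coset \<subseteq> cube K T" "twist \<subseteq> cube K T"
    unfolding double_coset_def twist_def using assms by (auto intro!: cubeI)
  ultimately show ?thesis by blast
qed

lemma cube_eq_cube_union:
  assumes "H \<subseteq> T" "x \<in> T" "T \<subseteq> H \<union> both_cosets"
  shows "cube K T = H \<union> double_coset \<union> twist"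
  using subset_cube[OF assms(1,2)] cube_mono[OF assms(3)] cube_both_cosets_subset by blast

section \<open>Sets with the same cube\<close>

text \<open>With \<open>t = hxk\<close>, the coset \<open>tHx = h(xHx)\<close> of \<open>xHx\<close> would be different from \<open>xHx\<close> if \<open>t\<close> were
  outside \<open>xH\<close>. It would then lie in \<open>H \<union> HxH\<close>, and so would \<open>xHx\<close>.\<close>

lemma double_coset_member_in_left_coset:
  assumes gen: "generate K (H \<union> {x}) = carrier K"
    and proper: "H \<union> double_coset \<union> twist \<noteq> carrier K"
    and products: "\<And>h. h \<in> H \<Longrightarrow> t \<otimes> h \<otimes> x \<in> H \<union> double_coset \<union> twist"
    and t: "t \<in> double_coset"
  shows "t \<in> x <# H"
proof (rule ccontr)
  assume outside: "t \<notin> x <# H"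
  obtain h k where hk: "h \<in> H" "k \<in> H" and t_eq: "t = h \<otimes> x \<otimes> k"
    using t by (rule double_cosetE)
  have "twist \<subseteq> H \<union> double_coset"
  proof
    fix y assume "y \<in> twist"
    then obtain l where l: "l \<in> H" "y = x \<otimes> l \<otimes> x" unfolding twist_def by blast
    have hy: "t \<otimes> (inv k \<otimes> l) \<otimes> x = h \<otimes> y"
    proof -
      have "k \<otimes> (inv k \<otimes> (l \<otimes> x)) = l \<otimes> x" using hk l by (simp add: m_assoc[symmetric])
      then show ?thesis using hk l t_eq by (simp add: m_assoc)
    qed
    have "h \<otimes> y \<notin> twist"
    proof
      assume "h \<otimes> y \<in> twist"
      then obtain m where m: "m \<in> H" "h \<otimes> y = x \<otimes> m \<otimes> x" unfolding twist_def by blast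
      have "(t \<otimes> (inv k \<otimes> l)) \<otimes> x = (x \<otimes> m) \<otimes> x" using m hy by simp
      then have "t \<otimes> (inv k \<otimes> l) = x \<otimes> m"
        using hk l m double_coset_carrier[OF t] by (subst (asm) right_cancel) auto
      then have "t = x \<otimes> m \<otimes> inv (inv k \<otimes> l)"
        using hk l m double_coset_carrier[OF t] by (subst inv_solve_right) auto
      also have "\<dots> = x \<otimes> (m \<otimes> inv (inv k \<otimes> l))" using hk l m by (simp add: m_assoc)
      also have "\<dots> \<in> x <# H" unfolding l_coset_def using hk l m by auto
      finally show False using outside by simp
    qed
    then have "h \<otimes> y \<in> H \<union> double_coset"
      using products[of "inv k \<otimes> l"] hy hk l by auto
    then show "y \<in> H \<union> double_coset" using hk l by (subst (asm) union_mult_left_iff) auto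
  qed
  then have "carrier K = H \<union> double_coset \<union> twist"
    using carrier_eq_union[OF gen] by blast
  then show False using proper by simp
qed

text \<open>The coset \<open>Ht\<close> avoids \<open>H \<union> HxH\<close> together with \<open>t\<close>. If it were contained in \<open>xHx\<close>, then \<open>H\<close>
  would be contained in \<open>xHx\<inverse>\<close>.\<close>

lemma twist_member_in_union:
  assumes gen: "generate K (H \<union> {x}) = carrier K"
    and not_normal: "\<not> H \<lhd> K"
    and products: "\<And>h. h \<in> H \<Longrightarrow> h \<otimes> t \<in> H \<union> double_coset \<union> twist"
    and t: "t \<in> twist"
  shows "t \<in> H \<union> double_coset"
proof (rule ccontr)
  assume outside: "t \<notin> H \<union> double_coset"
  obtain m where m: "m \<in> H" and t_eq: "t = x \<otimes> m \<otimes> x" using t unfolding twist_def by blast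
  have "h \<otimes> x \<in> x <# H" if h: "h \<in> H" for h
  proof -
    have "h \<otimes> t \<notin> H \<union> double_coset"
      using outside h m t_eq by (subst union_mult_left_iff) auto
    then have "h \<otimes> t \<in> twist" using products[OF h] by blast
    then obtain n where n: "n \<in> H" "h \<otimes> t = x \<otimes> n \<otimes> x" unfolding twist_def by blast
    have "(h \<otimes> x \<otimes> m) \<otimes> x = (x \<otimes> n) \<otimes> x" using n h m t_eq by (simp add: m_assoc)
    then have "h \<otimes> x \<otimes> m = x \<otimes> n" using h m n by (subst (asm) right_cancel) auto
    then have "h \<otimes> x = x \<otimes> n \<otimes> inv m" using h m n by (subst inv_solve_right) auto
    also have "\<dots> = x \<otimes> (n \<otimes> inv m)" using m n by (simp add: m_assoc)
    also have "\<dots> \<in> x <# H" unfolding l_coset_def using m n by auto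
    finally show ?thesis .
  qed
  then show False using normal_if_x_normalises[OF gen] not_normal by blast
qed

lemma symmetric_set_subset_both_cosets:
  assumes gen: "generate K (H \<union> {x}) = carrier K" and not_normal: "\<not> H \<lhd> K"
    and proper: "H \<union> double_coset \<union> twist \<noteq> carrier K"
    and T: "T \<subseteq> carrier K" "H \<subseteq> T" "x \<in> T"
    and T_inv: "\<And>t. t \<in> T \<Longrightarrow> inv t \<in> T"
    and cube_T: "cube K T = H \<union> double_coset \<union> twist"
  shows "T \<subseteq> H \<union> both_cosets"
proof
  fix t assume t: "t \<in> T"
  have products: "s \<otimes> h \<otimes> x \<in> H \<union> double_coset \<union> twist"
    if "s \<in> T" "h \<in> H" for s h
    using cubeI[of s T h x K] that T cube_T by auto
  have left_products: "h \<otimes> t \<in> H \<union> double_coset \<union> twist" if h: "h \<in> H" for h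
  proof -
    have "h \<otimes> t \<otimes> \<one> \<in> cube K T" using h t T by (intro cubeI) auto
    then show ?thesis using h t T cube_T by auto
  qed
  have left_coset: "s \<in> x <# H" if "s \<in> T" "s \<in> double_coset" for s
    using double_coset_member_in_left_coset[OF gen proper products] that by blast
  have "t \<in> H \<union> double_coset \<union> twist" using left_products[of \<one>] t T by auto
  then have "t \<in> H \<union> double_coset"
    using twist_member_in_union[OF gen not_normal left_products] by blast
  then show "t \<in> H \<union> both_cosets"
  proof
    assume d: "t \<in> double_coset"
    \<comment> \<open>Inversion turns the left coset \<open>xH\<close> into the right coset \<open>Hx\<inverse> = Hx\<close>.\<close>
    obtain k where k: "k \<in> H" "inv t = x \<otimes> k"
      using left_coset[of "inv t"] T_inv[OF t] double_coset_inv[OF d] unfolding l_coset_def by blast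
    have "t = inv (x \<otimes> k)" using k t T by (metis inv_inv subsetD)
    also have "\<dots> = inv k \<otimes> inv x" using k by (simp add: inv_mult_group)
    also have "\<dots> = (inv k \<otimes> inv (x \<otimes> x)) \<otimes> x"
      using k by (subst inv_x_left) (simp add: m_assoc)
    finally have "t \<in> H #> x" unfolding r_coset_def using k square by auto
    then show ?thesis using left_coset[OF t d] by simp
  qed simp
qed

end

section \<open>The largest symmetric superset with the same cube\<close>

theorem proposition3p3:
  fixes K :: "('a, 'b) monoid_scheme" (structure)
    and H S :: "'a set" and x :: 'a
  assumes "group K" and "finite (carrier K)"
    and "subgroup H K" and "\<not> H \<lhd> K"
    and "x \<in> carrier K" and "generate K (H \<union> {x}) = carrier K"
    and "x \<otimes> x \<in> H" and "group.ord K x > 2"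
    and "S = H \<union> {x, inv x}"
    and "cube K S \<noteq> carrier K"
  shows "H \<union> ((H #> x) \<inter> (x <# H)) \<in> symmetric_cube_supersets K S \<and>
    (\<forall>T \<in> symmetric_cube_supersets K S. T \<subseteq> H \<union> ((H #> x) \<inter> (x <# H)))"
proof -
  interpret square_in_subgroup K H x
    using assms by (simp add: square_in_subgroup_def square_in_subgroup_axioms_def)
  have S_sub: "S \<subseteq> H \<union> both_cosets"
    using assms(9) x_both_cosets both_cosets_inv[OF x_both_cosets] by simp
  have cube_S: "cube K S = H \<union> double_coset \<union> twist"
    using assms(9) S_sub by (intro cube_eq_cube_union) auto
  have M_inv: "inv a \<in> H \<union> both_cosets" if "a \<in> H \<union> both_cosets" for a
    using that both_cosets_inv[of a] H_inv[of a] by blast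
  have M_carrier: "H \<union> both_cosets \<subseteq> carrier K" using both_cosets_carrier H_carrier by blast
  have "cube K (H \<union> both_cosets) = H \<union> double_coset \<union> twist"
    using x_both_cosets by (intro cube_eq_cube_union) auto
  moreover have "H \<union> both_cosets = set_inv (H \<union> both_cosets)"
  proof
    show "set_inv (H \<union> both_cosets) \<subseteq> H \<union> both_cosets"
      using M_inv unfolding SET_INV_def by blast
    show "H \<union> both_cosets \<subseteq> set_inv (H \<union> both_cosets)"
    proof
      fix a assume a: "a \<in> H \<union> both_cosets"
      then have "a = inv (inv a)" using M_carrier by (metis inv_inv subsetD)
      then show "a \<in> set_inv (H \<union> both_cosets)"
        using M_inv[OF a] unfolding SET_INV_def by blast
    qed
  qed
  ultimately have "H \<union> both_cosets \<in> symmetric_cube_supersets K S"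
    unfolding symmetric_cube_supersets_def using cube_S S_sub M_carrier by simp
  moreover have "T \<subseteq> H \<union> both_cosets" if T: "T \<in> symmetric_cube_supersets K S" for T
  proof (rule symmetric_set_subset_both_cosets)
    have T_props: "T \<subseteq> carrier K" "cube K S = cube K T" "T = set_inv T" "S \<subseteq> T"
      using T unfolding symmetric_cube_supersets_def by auto
    show "H \<subseteq> T" "x \<in> T" "T \<subseteq> carrier K" using T_props assms(9) by auto
    show "inv t \<in> T" if "t \<in> T" for t
      using that T_props(3) unfolding SET_INV_def by blast
    show "cube K T = H \<union> double_coset \<union> twist" using T_props(2) cube_S by simp
    show "H \<union> double_coset \<union> twist \<noteq> carrier K" using cube_S assms(10) by simp
  qed (use assms in auto)
  ultimately show ?thesis by blast
qed

end
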